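(* Let $k\geq 2$ and let $\varphi\colon\mathcal{A}\to\mathcal{A}^*$ be a (growing) substitution of constant length $k$ on a finite alphabet $\mathcal{A}$. Let $Y\subset\mathcal{B}^{\mathbf{Z}}$ be a subshift and let $\pi\colon X_{\varphi}\to Y$ be a factor map. Then: (1) A sequence $y\in Y$ is $k$-automatic if and only if $y=\pi(x)$ for some quasi-fixed point $x$ of $\varphi$ (with $x\in X_\varphi$). (2) If $y\in Y$ is $k$-automatic and nonperiodic, then every point of $\pi^{-1}(y)\subset X_\varphi$ is a quasi-fixed point of $\varphi$.
   Context: A substitution $\varphi\colon\mathcal{A}\to\mathcal{A}^*$ assigns to each letter a finite word; it is assumed growing, i.e. $|\varphi^n(a)|\to\infty$ for every $a\in\mathcal{A}$; it has constant length $k$ if $|\varphi(a)|=k$ for all $a$. It acts on $\mathcal{A}^{\mathbf{Z}}$ by concatenation: $\varphi(\ldots x_{-1}.x_0x_1\ldots)=\ldots\varphi(x_{-1}).\varphi(x_0)\varphi(x_1)\ldots$, where the dot marks position $0$. $T$ denotes the shift $(Tx)_n=x_{n+1}$ on $\mathcal{A}^{\mathbf{Z}}$. $X_\varphi=\{x\in\mathcal{A}^{\mathbf{Z}}:$ every finite factor of $x$ appears in $\varphi^n(a)$ for some $a\in\mathcal{A}$, $n\geq 0\}$. A subshift is a closed shift-invariant subset of $\mathcal{B}^{\mathbf{Z}}$ ($\mathcal{B}$ finite); a factor map is a continuous surjection commuting with the shifts. A point $y$ is periodic if $T^p y=y$ for some $p\geq 1$. A point $z\in\mathcal{A}^{\mathbf{Z}}$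 is a quasi-fixed point of $\varphi$ if $T^c(\varphi^m(z))=z$ for some $m\geq 1$, $c\in\mathbf{Z}$. A two-sided sequence is $k$-automatic if it is the image under a coding (letter-to-letter map) of a two-sided fixed point of some substitution of constant length $k$; equivalently, both one-sided sequences $(y_n)_{n\geq 0}$ and $(y_{-n-1})_{n\geq 0}$ are $k$-automatic in the usual sense. *)

theory Defs
  imports "HOL-Analysis.Analysis" "HOL-Library.Sublist"
begin

definition seq_top :: "(int \<Rightarrow> 'b) topology" where
  "seq_top = product_topology (\<lambda>_. discrete_topology UNIV) UNIV"

definition shiftc :: "int \<Rightarrow> (int \<Rightarrow> 'b) \<Rightarrow> (int \<Rightarrow> 'b)" where
  "shiftc c x = (\<lambda>n. x (n + c))"

definition shift :: "(int \<Rightarrow> 'b) \<Rightarrow> (int \<Rightarrow> 'b)" where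
  "shift x = shiftc 1 x"

definition subst_word :: "('a \<Rightarrow> 'a list) \<Rightarrow> 'a list \<Rightarrow> 'a list" where
  "subst_word \<phi> w = concat (map \<phi> w)"

definition constant_length :: "nat \<Rightarrow> ('a \<Rightarrow> 'a list) \<Rightarrow> bool" where
  "constant_length k \<phi> \<longleftrightarrow> (\<forall>a. length (\<phi> a) = k)"

definition growing :: "('a \<Rightarrow> 'a list) \<Rightarrow> bool" where
  "growing \<phi> \<longleftrightarrow> (\<forall>a. filterlim (\<lambda>n. length ((subst_word \<phi> ^^ n) [a])) at_top sequentially)"

text \<open>Action of a substitution of constant length k on two-sided sequences by
  concatenation, with phi(x_0) starting at position 0: block phi(x_n) occupies
  positions kn,...,kn+k-1.\<close>
definition subst_seq :: "nat \<Rightarrow> ('a \<Rightarrow> 'a list) \<Rightarrow> (int \<Rightarrow> 'a) \<Rightarrow> (int \<Rightarrow> 'a)" where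
  "subst_seq k \<phi> x = (\<lambda>n. \<phi> (x (n div int k)) ! nat (n mod int k))"

definition window :: "(int \<Rightarrow> 'a) \<Rightarrow> int \<Rightarrow> nat \<Rightarrow> 'a list" where
  "window x i m = map (\<lambda>j. x (i + int j)) [0..<m]"

definition subst_shift :: "('a \<Rightarrow> 'a list) \<Rightarrow> (int \<Rightarrow> 'a) set" where
  "subst_shift \<phi> = {x. \<forall>i m. \<exists>a n. sublist (window x i m) ((subst_word \<phi> ^^ n) [a])}"

definition subshift :: "(int \<Rightarrow> 'b) set \<Rightarrow> bool" where
  "subshift Y \<longleftrightarrow> closedin seq_top Y \<and> (\<forall>y\<in>Y. shift y \<in> Y)"

definition factor_map ::
    "(int \<Rightarrow> 'a) set \<Rightarrow> (int \<Rightarrow> 'b) set \<Rightarrow> ((int \<Rightarrow> 'a) \<Rightarrow> (int \<Rightarrow> 'b)) \<Rightarrow> bool" where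
  "factor_map X Y \<pi> \<longleftrightarrow>
     continuous_map (subtopology seq_top X) (subtopology seq_top Y) \<pi> \<and>
     \<pi> ` X = Y \<and> (\<forall>x\<in>X. \<pi> (shift x) = shift (\<pi> x))"

definition periodic :: "(int \<Rightarrow> 'b) \<Rightarrow> bool" where
  "periodic y \<longleftrightarrow> (\<exists>p::nat. p \<ge> 1 \<and> (shift ^^ p) y = y)"

definition quasi_fixed :: "nat \<Rightarrow> ('a \<Rightarrow> 'a list) \<Rightarrow> (int \<Rightarrow> 'a) \<Rightarrow> bool" where
  "quasi_fixed k \<phi> z \<longleftrightarrow> (\<exists>m::nat. \<exists>c::int. m \<ge> 1 \<and> shiftc c ((subst_seq k \<phi> ^^ m) z) = z)"

definition automatic :: "nat \<Rightarrow> (int \<Rightarrow> 'b) \<Rightarrow> bool" where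
  "automatic k y \<longleftrightarrow>
     (\<exists>(C::nat set) (\<sigma>::nat \<Rightarrow> nat list) (w::int \<Rightarrow> nat) (\<tau>::nat \<Rightarrow> 'b).
        finite C \<and> (\<forall>c\<in>C. length (\<sigma> c) = k \<and> set (\<sigma> c) \<subseteq> C) \<and>
        range w \<subseteq> C \<and> subst_seq k \<sigma> w = w \<and> y = \<tau> \<circ> w)"

end

theory Submission
  imports Defs
begin

text \<open>
  Write \<open>\<Phi>\<close> for the action of the substitution on sequences and \<open>T\<^sup>c\<close> for shifts. Every point \<open>x\<close> of
  the substitution shift can be desubstituted: \<open>x = T\<^bsup>c n\<^esup> \<Phi>\<^sup>n x\<^sub>n\<close> with \<open>0 \<le> c n < k\<^sup>n\<close>. The factor map is
  a sliding block code \<open>\<pi>\<close>. If \<open>y = \<pi> x\<close> is automatic, the sets \<open>V\<^sub>n = {u. \<pi> (T\<^bsup>c n\<^esup> \<Phi>\<^sup>n u) = y}\<close> take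
  only finitely many values, so infinitely many of them coincide with one set \<open>V\<close>, and \<open>x\<^sub>n\<close> may be
  assumed constant around the origin for those \<open>n\<close>. For \<open>n < m\<close> of this kind the return map
  \<open>\<Psi> = T\<^sup>e \<Phi>\<^bsup>m-n\<^esup>\<close> with \<open>x\<^sub>n = \<Psi> x\<^sub>m\<close> preserves \<open>V\<close>. It expands agreement around the origin, so
  its iterates at \<open>x\<^sub>n\<close> accumulate at a fixed point in \<open>V\<close>, which yields a quasi-fixed preimage of \<open>y\<close>.
  If \<open>y\<close> is not periodic, the return maps for different \<open>m\<close> commute, and then \<open>x\<^sub>n\<close> itself, being
  the limit of \<open>\<Psi> u\<close> as \<open>m\<close> grows for every \<open>u\<close> that agrees with it around the origin, is fixed by
  each of them. Conversely, a quasi-fixed point equation makes the values of \<open>\<pi> x\<close> near \<open>k i + r\<close>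
  depend on finitely many values of \<open>x\<close> near \<open>i\<close>.
\<close>

section \<open>Agreement around the origin and compactness of the full shift\<close>

definition agree :: "nat \<Rightarrow> (int \<Rightarrow> 'a) \<Rightarrow> (int \<Rightarrow> 'a) \<Rightarrow> bool" where
  "agree D u v \<longleftrightarrow> (\<forall>p. \<bar>p\<bar> \<le> int D \<longrightarrow> u p = v p)"

lemma agreeD: "agree D u v \<Longrightarrow> \<bar>p\<bar> \<le> int D \<Longrightarrow> u p = v p"
  by (simp add: agree_def)

lemma agree_refl [simp]: "agree D u u"
  by (simp add: agree_def)

lemma agree_sym: "agree D u v \<Longrightarrow> agree D v u"
  by (simp add: agree_def)

lemma agree_trans: "agree D u v \<Longrightarrow> agree D v w \<Longrightarrow> agree D u w"
  by (simp add: agree_def)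

lemma agree_mono: "agree D u v \<Longrightarrow> E \<le> D \<Longrightarrow> agree E u v"
  by (auto simp: agree_def)

lemma agree_all_eq:
  assumes "\<And>D. agree D u v"
  shows "u = v"
proof
  fix p
  show "u p = v p" using agreeD[OF assms[of "nat \<bar>p\<bar>"], of p] by simp
qed

lemma int_le_div_iff:
  assumes "(K::int) > 0"
  shows "a \<le> p div K \<longleftrightarrow> a * K \<le> p"
proof
  assume "a \<le> p div K"
  then have "a * K \<le> p div K * K" using assms by simp
  also have "\<dots> \<le> p" using assms pos_mod_sign[of K p] div_mult_mod_eq[of p K] by linarith
  finally show "a * K \<le> p" .
next
  assume "a * K \<le> p"
  from zdiv_mono1[OF this assms] show "a \<le> p div K" using assms by simp
qed

lemma int_div_less_iff: "(K::int) > 0 \<Longrightarrow> p div K < b \<longleftrightarrow> p < b * K"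
  using int_le_div_iff[of K b p] by linarith

text \<open>Pigeonhole: over a finite alphabet only finitely many patterns occur on
  \<open>[-D, D]\<close>.\<close>

lemma infinite_subset_agree:
  fixes z :: "nat \<Rightarrow> int \<Rightarrow> 'a::finite"
  assumes "infinite S"
  shows "\<exists>S'. infinite S' \<and> S' \<subseteq> S \<and> (\<forall>M\<in>S'. \<forall>M'\<in>S'. agree D (z M) (z M'))"
proof -
  let ?I = "{p. \<bar>p\<bar> \<le> int D}"
  let ?f = "\<lambda>M. restrict (z M) ?I"
  have eq: "?I = {- int D..int D}" by auto
  have "finite (PiE ?I (\<lambda>_. UNIV :: 'a set))"
    unfolding eq by (intro finite_PiE) auto
  moreover have "?f ` S \<subseteq> PiE ?I (\<lambda>_. UNIV)" by (intro image_subsetI restrict_PiE_iff[THEN iffD2]) simp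
  ultimately have "finite (?f ` S)" using finite_subset by blast
  from pigeonhole_infinite[OF assms this] obtain M0
    where "infinite {M \<in> S. ?f M = ?f M0}" by blast
  moreover have "agree D (z M) (z M')" if "?f M = ?f M0" "?f M' = ?f M0" for M M'
    unfolding agree_def
  proof (intro allI impI)
    fix p assume p: "\<bar>p\<bar> \<le> int D"
    have "?f M p = ?f M' p" using that by simp
    with p show "z M p = z M' p" by simp
  qed
  ultimately show ?thesis
    by (intro exI[of _ "{M \<in> S. ?f M = ?f M0}"]) auto
qed

text \<open>Compactness by a diagonal argument over nested infinite index sets. The conclusion
  speaks of infinite sets of indices, not of a subsequence, so that users can ask for an index as
  large as they wish.\<close>

lemma cluster_point_exists:
  fixes z :: "nat \<Rightarrow> int \<Rightarrow> 'a::finite"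
  assumes "infinite S"
  shows "\<exists>u. \<forall>D. infinite {M \<in> S. agree D (z M) u}"
proof -
  define P where "P D S' \<longleftrightarrow> infinite S' \<and> S' \<subseteq> S \<and> (\<forall>M\<in>S'. \<forall>M'\<in>S'. agree D (z M) (z M'))" for D S'
  have "\<exists>T. \<forall>D. P D (T D) \<and> T (Suc D) \<subseteq> T D"
  proof (rule dependent_nat_choice)
    show "\<exists>T. P 0 T" unfolding P_def by (rule infinite_subset_agree[OF assms])
  next
    fix T D assume "P D T"
    then have "infinite T" "T \<subseteq> S" by (auto simp: P_def)
    from infinite_subset_agree[OF this(1), of "Suc D" z] obtain T' where T': "infinite T'"
      "T' \<subseteq> T" "\<forall>M\<in>T'. \<forall>M'\<in>T'. agree (Suc D) (z M) (z M')" by auto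
    then have "P (Suc D) T'" using \<open>T \<subseteq> S\<close> by (auto simp: P_def)
    with T'(2) show "\<exists>T'. P (Suc D) T' \<and> T' \<subseteq> T" by auto
  qed
  then obtain T where T: "\<And>D. P D (T D)" "\<And>D. T (Suc D) \<subseteq> T D" by blast
  have mono: "T D \<subseteq> T E" if "E \<le> D" for D E
    using lift_Suc_antimono_le[of T, OF T(2) that] .
  \<comment> \<open>All members of \<open>T D\<close> agree up to radius \<open>D\<close>, so the
    letter at \<open>p\<close> may be read off any member of the set with index
    \<open>\<bar>p\<bar>\<close>.\<close>
  define u where "u p = z (SOME M. M \<in> T (nat \<bar>p\<bar>)) p" for p
  have "agree D (z M) u" if "M \<in> T D" for D M
    unfolding agree_def
  proof (intro allI impI)
    fix p :: int assume p: "\<bar>p\<bar> \<le> int D"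
    have 1: "M \<in> T (nat \<bar>p\<bar>)" using that mono[of "nat \<bar>p\<bar>" D] p by (simp add: nat_le_iff subset_iff)
    then have 2: "(SOME M. M \<in> T (nat \<bar>p\<bar>)) \<in> T (nat \<bar>p\<bar>)" by (rule someI)
    have "agree (nat \<bar>p\<bar>) (z M) (z (SOME M. M \<in> T (nat \<bar>p\<bar>)))"
      using T(1)[of "nat \<bar>p\<bar>"] 1 2 unfolding P_def by blast
    then show "z M p = u p" unfolding u_def by (rule agreeD) simp
  qed
  then have "T D \<subseteq> {M \<in> S. agree D (z M) u}" for D
    using T(1)[of D] by (auto simp: P_def)
  moreover have "infinite (T D)" for D using T(1)[of D] by (simp add: P_def)
  ultimately have "infinite {M \<in> S. agree D (z M) u}" for D
    using infinite_super by blast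
  then show ?thesis by blast
qed

section \<open>Shifts and iterates of the substitution on sequences\<close>

lemma shiftc_shiftc: "shiftc a (shiftc b x) = shiftc (a + b) x"
  by (auto simp: shiftc_def algebra_simps)

lemma shiftc_0 [simp]: "shiftc 0 x = x"
  by (simp add: shiftc_def)

text \<open>For \<open>0 \<le> r < k ^ n\<close> and constant length \<open>k\<close>, this is the
  letter at position \<open>r\<close> of the \<open>n\<close>-th image of \<open>a\<close>. Working
  with positions instead of words, \<open>funpow_subst_seq\<close> also covers the substitution
  behind an automatic sequence, whose images have length \<open>k\<close> only for letters of its
  own alphabet.\<close>

primrec iterate_letter :: "nat \<Rightarrow> ('a \<Rightarrow> 'a list) \<Rightarrow> nat \<Rightarrow> int \<Rightarrow> 'a \<Rightarrow> 'a" where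
  "iterate_letter k \<phi> 0 r a = a"
| "iterate_letter k \<phi> (Suc n) r a =
     \<phi> (iterate_letter k \<phi> n (r div int k) a) ! nat (r mod int k)"

lemma funpow_subst_seq:
  assumes "k > 0"
  shows "(subst_seq k \<phi> ^^ n) u p =
    iterate_letter k \<phi> n (p mod int k ^ n) (u (p div int k ^ n))"
proof (induction n arbitrary: p)
  case 0
  then show ?case by simp
next
  case (Suc n)
  have 1: "p div int k div int k ^ n = p div int k ^ Suc n"
    using assms by (simp add: zdiv_zmult2_eq)
  have 2: "p mod int k ^ Suc n = int k * (p div int k mod int k ^ n) + p mod int k"
    using assms by (simp add: zmod_zmult2_eq)
  have 3: "(p mod int k ^ Suc n) div int k = p div int k mod int k ^ n"
    unfolding 2 using assms by (subst div_mult_self4) auto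
  have 4: "(p mod int k ^ Suc n) mod int k = p mod int k"
    unfolding 2 by simp
  show ?case
    unfolding iterate_letter.simps 3 4 by (simp add: subst_seq_def[of k \<phi> "(subst_seq k \<phi> ^^ n) u"] Suc 1 del: power_Suc)
qed

lemma subst_seq_shiftc:
  assumes "k > 0"
  shows "subst_seq k \<phi> (shiftc c u) = shiftc (int k * c) (subst_seq k \<phi> u)"
  using assms by (auto simp: subst_seq_def shiftc_def add.commute)

lemma funpow_subst_seq_shiftc:
  assumes "k > 0"
  shows "(subst_seq k \<phi> ^^ n) (shiftc c u) = shiftc (int k ^ n * c) ((subst_seq k \<phi> ^^ n) u)"
  by (induction n) (simp_all add: subst_seq_shiftc[OF assms] mult.assoc)

lemma funpow_swap: "(f ^^ m) ((f ^^ n) x) = (f ^^ n) ((f ^^ m) x)"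
proof -
  have "(f ^^ m) ((f ^^ n) x) = (f ^^ (n + m)) x" by (simp add: add.commute[of n] funpow_add)
  then show ?thesis by (simp add: funpow_add)
qed

text \<open>The \<open>j\<close>-th iterate commutes with the \<open>n\<close>-th one, and moving an
  iterate past a shift only multiplies the shift, so the fixed point equation survives with another
  shift. This carries fixed points of return maps back to the level of \<open>x\<close>.\<close>

lemma quasi_fixed_shiftc_funpow:
  assumes k: "k > 0" and j: "j \<ge> 1" and fixed: "shiftc e ((subst_seq k \<phi> ^^ j) z) = z"
  shows "quasi_fixed k \<phi> (shiftc c ((subst_seq k \<phi> ^^ n) z))"
proof -
  have "shiftc (- e) z = (subst_seq k \<phi> ^^ j) z"
    by (subst fixed[symmetric]) (simp add: shiftc_shiftc)
  then have "(subst_seq k \<phi> ^^ j) ((subst_seq k \<phi> ^^ n) z) =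
      shiftc (- (int k ^ n * e)) ((subst_seq k \<phi> ^^ n) z)"
    using funpow_subst_seq_shiftc[OF k, of n \<phi> "- e" z]
      funpow_swap[of j "subst_seq k \<phi>" n z] by simp
  then have "shiftc (c - int k ^ j * c + int k ^ n * e)
      ((subst_seq k \<phi> ^^ j) (shiftc c ((subst_seq k \<phi> ^^ n) z))) =
      shiftc c ((subst_seq k \<phi> ^^ n) z)"
    by (simp add: funpow_subst_seq_shiftc[OF k] shiftc_shiftc)
  then show ?thesis unfolding quasi_fixed_def using j by blast
qed

text \<open>The bound says that every position read lies in one of the blocks produced by the
  letters at \<open>-D, ..., D\<close>; the last of these blocks ends just before
  \<open>(D + 1) * K\<close>.\<close>

lemma agree_shiftc_funpow:
  assumes K: "k > 0" "int k ^ n = K" and uv: "agree D u v"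
    and bound: "\<And>p. \<bar>p\<bar> \<le> int E \<Longrightarrow> - int D * K \<le> p + e \<and> p + e < (int D + 1) * K"
  shows "agree E (shiftc e ((subst_seq k \<phi> ^^ n) u)) (shiftc e ((subst_seq k \<phi> ^^ n) v))"
  unfolding agree_def
proof (intro allI impI)
  fix p assume "\<bar>p\<bar> \<le> int E"
  note b = bound[OF this]
  have K0: "K > 0" using K by auto
  have "- int D \<le> (p + e) div K"
    using b K0 by (simp add: int_le_div_iff)
  moreover have "(p + e) div K < int D + 1"
    using b int_div_less_iff[OF K0] by blast
  ultimately have "u ((p + e) div K) = v ((p + e) div K)"
    by (intro agreeD[OF uv]) auto
  then show "shiftc e ((subst_seq k \<phi> ^^ n) u) p = shiftc e ((subst_seq k \<phi> ^^ n) v) p"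
    by (simp add: shiftc_def funpow_subst_seq[OF K(1)] K(2))
qed

section \<open>Windows, the language, and invariance and closedness of the substitution
  shift\<close>

lemma length_window [simp]: "length (window x i m) = m"
  by (simp add: window_def)

lemma nth_window [simp]: "j < m \<Longrightarrow> window x i m ! j = x (i + int j)"
  by (simp add: window_def)

lemma window_append: "window x i (a + b) = window x i a @ window x (i + int a) b"
  by (rule nth_equalityI) (auto simp: nth_append algebra_simps)

lemma sublist_window:
  assumes "i \<le> i'" "i' + int m' \<le> i + int m"
  shows "sublist (window x i' m') (window x i m)"
proof -
  define a where "a = nat (i' - i)"
  define b where "b = m - (a + m')"
  have m: "m = (a + m') + b" and i: "i' = i + int a"
    using assms by (auto simp: a_def b_def)
  show ?thesis unfolding m i window_append[of x i "a + m'"] window_append[of x i a]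
    by (auto simp: sublist_def)
qed

lemma window_shiftc: "window (shiftc c x) i m = window x (i + c) m"
  by (simp add: window_def shiftc_def algebra_simps)

lemma window_agree:
  assumes "agree D u v" "- int D \<le> i" "i + int m \<le> int D + 1"
  shows "window u i m = window v i m"
  by (rule nth_equalityI) (use assms in \<open>auto simp: agree_def\<close>)

lemma subst_word_append: "subst_word \<phi> (u @ v) = subst_word \<phi> u @ subst_word \<phi> v"
  by (simp add: subst_word_def)

lemma window_subst_seq:
  assumes "constant_length k \<phi>" "k > 0"
  shows "window (subst_seq k \<phi> x) (int k * i) (k * m) = subst_word \<phi> (window x i m)"
proof (induction m)
  case 0
  then show ?case by (simp add: window_def subst_word_def)
next
  case (Suc m)
  have len: "length (\<phi> a) = k" for a using assms by (simp add: constant_length_def)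
  have 1: "window (subst_seq k \<phi> x) (int k * i + int (k * m)) k = \<phi> (x (i + int m))"
  proof (rule nth_equalityI)
    fix j assume "j < length (window (subst_seq k \<phi> x) (int k * i + int (k * m)) k)"
    then have j: "j < k" by simp
    have e: "int k * i + int (k * m) + int j = int j + int k * (i + int m)"
      by (simp add: algebra_simps)
    show "window (subst_seq k \<phi> x) (int k * i + int (k * m)) k ! j = \<phi> (x (i + int m)) ! j"
      using j assms(2) by (simp add: subst_seq_def e del: of_nat_mult)
  qed (simp add: len)
  have "window x i (Suc m) = window x i m @ [x (i + int m)]"
    using window_append[of x i m 1] by (simp add: window_def)
  moreover have "k * Suc m = k * m + k" by simp
  ultimately show ?case
    using Suc 1 window_append[of "subst_seq k \<phi> x" "int k * i" "k * m" k]
    by (simp add: subst_word_append add.commute[of k]) (simp add: subst_word_def)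
qed

definition language :: "('a \<Rightarrow> 'a list) \<Rightarrow> 'a list set" where
  "language \<phi> = {w. \<exists>a n. sublist w ((subst_word \<phi> ^^ n) [a])}"

lemma subst_shift_iff: "x \<in> subst_shift \<phi> \<longleftrightarrow> (\<forall>i m. window x i m \<in> language \<phi>)"
  by (simp add: subst_shift_def language_def)

lemma language_sublist: "w \<in> language \<phi> \<Longrightarrow> sublist v w \<Longrightarrow> v \<in> language \<phi>"
  unfolding language_def using sublist_order.order_trans by blast

lemma subst_word_sublist: "sublist v w \<Longrightarrow> sublist (subst_word \<phi> v) (subst_word \<phi> w)"
  unfolding sublist_def by (metis subst_word_append)

lemma language_subst_word: 
  assumes "w \<in> language \<phi>"
  shows "subst_word \<phi> w \<in> language \<phi>"
proof -
  obtain a n where "sublist w ((subst_word \<phi> ^^ n) [a])"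
    using assms by (auto simp: language_def)
  from subst_word_sublist[OF this, of \<phi>]
  have "sublist (subst_word \<phi> w) ((subst_word \<phi> ^^ Suc n) [a])" by simp
  then show ?thesis unfolding language_def by blast
qed

lemma shiftc_in_subst_shift: "x \<in> subst_shift \<phi> \<Longrightarrow> shiftc c x \<in> subst_shift \<phi>"
  by (simp add: subst_shift_iff window_shiftc)

lemma subst_seq_in_subst_shift:
  assumes "constant_length k \<phi>" "k > 0" "x \<in> subst_shift \<phi>"
  shows "subst_seq k \<phi> x \<in> subst_shift \<phi>"
  unfolding subst_shift_iff
proof (intro allI)
  fix i m
  have "i div int k * int k \<le> i"
    using assms(2) int_le_div_iff[of "int k" "i div int k" i] by simp
  moreover have "i < (i div int k + 1) * int k"
    using assms(2) int_div_less_iff[of "int k" i "i div int k + 1"] by simp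
  moreover have "int m \<le> int k * int m"
    using assms(2) mult_right_mono[of 1 "int k" "int m"] by simp
  \<comment> \<open>Moving the left end back to a multiple of \<open>k\<close> costs less than one
    block, so \<open>m + 1\<close> blocks cover the window.\<close>
  ultimately have "sublist (window (subst_seq k \<phi> x) i m)
      (window (subst_seq k \<phi> x) (int k * (i div int k)) (k * (m + 1)))"
    by (intro sublist_window) (simp_all add: algebra_simps)
  then show "window (subst_seq k \<phi> x) i m \<in> language \<phi>"
    unfolding window_subst_seq[OF assms(1,2)]
    using assms(3) language_subst_word language_sublist unfolding subst_shift_iff by blast
qed

lemma funpow_subst_seq_in_subst_shift:
  assumes "constant_length k \<phi>" "k > 0" "x \<in> subst_shift \<phi>"
  shows "(subst_seq k \<phi> ^^ n) x \<in> subst_shift \<phi>"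
  by (induction n) (simp_all add: assms subst_seq_in_subst_shift)

lemma subst_shift_closed:
  assumes "\<And>D. \<exists>v\<in>subst_shift \<phi>. agree D u v"
  shows "u \<in> subst_shift \<phi>"
  unfolding subst_shift_iff
proof (intro allI)
  fix i m
  obtain v where v: "v \<in> subst_shift \<phi>" "agree (nat \<bar>i\<bar> + m) u v" using assms by blast
  have "window u i m = window v i m"
    by (rule window_agree[OF v(2)]) auto
  then show "window u i m \<in> language \<phi>" using v(1) by (simp add: subst_shift_iff)
qed

section \<open>Desubstitution\<close>

text \<open>A long central window of \<open>x\<close> occurs in some iterated image of a letter;
  cutting that word at block boundaries shows a factor of the previous iterate. Only finitely many
  letters of \<open>u\<close> are controlled, and the passage to a limit is left to
  \<open>desubstitution\<close>.\<close>

lemma approximate_desubstitution: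
  assumes cl: "constant_length k \<phi>" and k: "k \<ge> 2" and x: "x \<in> subst_shift \<phi>"
  shows "\<exists>d u. d < k \<and> agree D (shiftc (int d) (subst_seq k \<phi> u)) x \<and>
    (\<forall>i m. - int D \<le> i \<longrightarrow> i + int m \<le> int D \<longrightarrow> window u i m \<in> language \<phi>)"
proof -
  \<comment> \<open>Large enough to leave \<open>D\<close> letters on either side of the origin
    after division by \<open>k\<close>, and to exclude that the window sits in a one-letter
    word.\<close>
  define M where "M = k * (D + 1)"
  have M: "M \<ge> 2" "M \<ge> D"
    using k mult_le_mono[of 2 k 1 "D + 1"] mult_le_mono[of 1 k "D" "D + 1"] by (auto simp: M_def)
  obtain a N where N: "sublist (window x (- int M) (2 * M + 1)) ((subst_word \<phi> ^^ N) [a])"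
    using x unfolding subst_shift_def by blast
  have "N \<noteq> 0"
  proof
    assume "N = 0"
    then have "2 * M + 1 \<le> 1" using sublist_length_le[OF N] by simp
    then show False using M by simp
  qed
  then obtain n where n: "N = Suc n" using not0_implies_Suc by blast
  define v where "v = (subst_word \<phi> ^^ n) [a]"
  \<comment> \<open>An arbitrary two-sided extension of the word \<open>v\<close>, to which
    \<open>subst_seq\<close> can be applied; all windows used below stay inside
    \<open>v\<close>.\<close>
  define vv where "vv i = v ! nat i" for i :: int
  have wv: "window vv 0 (length v) = v"
    by (rule nth_equalityI) (auto simp: vv_def)
  have sv: "subst_word \<phi> v = window (subst_seq k \<phi> vv) 0 (k * length v)"
    using window_subst_seq[OF cl, of vv 0 "length v"] k wv by simp
  obtain ps ss where "subst_word \<phi> v = ps @ window x (- int M) (2 * M + 1) @ ss"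
    using N unfolding n v_def sublist_def by auto
  then have W: "window (subst_seq k \<phi> vv) 0 (k * length v) = ps @ window x (- int M) (2 * M + 1) @ ss"
    using sv by simp
  define q where "q = length ps"
  have len: "q + 2 * M + 1 \<le> k * length v"
    using arg_cong[OF W, of length] by (simp add: q_def)
  have val: "subst_seq k \<phi> vv (int q + int M + p) = x p" if "\<bar>p\<bar> \<le> int M" for p
  proof -
    define t where "t = nat (p + int M)"
    have t: "t < 2 * M + 1" "p = int t - int M" using that by (auto simp: t_def)
    have "window (subst_seq k \<phi> vv) 0 (k * length v) ! (q + t) = x p"
      unfolding W using t by (simp add: nth_append q_def)
    moreover have "q + t < k * length v" using t len by simp
    ultimately show ?thesis using t(2) by simp
  qed
  \<comment> \<open>The origin of \<open>x\<close> falls on position \<open>q + M\<close> of the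
    substituted word, that is, on offset \<open>d\<close> of block \<open>Q\<close>.\<close>
  define d where "d = (q + M) mod k"
  define Q where "Q = (q + M) div k"
  have qM: "q + M = k * Q + d" by (simp add: d_def Q_def)
  have d: "d < k" using k by (simp add: d_def)
  have "k * D < k * (Q + 1)"
    using qM d by (simp add: M_def)
  then have QD: "D \<le> Q" by (simp only: nat_mult_less_cancel_disj) simp
  have "k * (Q + (D + 1)) < k * length v"
    using qM len by (simp add: M_def algebra_simps)
  then have DQ: "Q + (D + 1) < length v" by (simp only: nat_mult_less_cancel_disj)
  define u where "u = shiftc (int Q) vv"
  have eq: "shiftc (int d) (subst_seq k \<phi> u) = shiftc (int q + int M) (subst_seq k \<phi> vv)"
    unfolding u_def using k qM
    by (simp add: subst_seq_shiftc shiftc_shiftc algebra_simps flip: of_nat_mult of_nat_add)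
  have "agree D (shiftc (int d) (subst_seq k \<phi> u)) x"
    unfolding eq agree_def using val M by (auto simp: shiftc_def algebra_simps)
  moreover have "window u i m \<in> language \<phi>" if "- int D \<le> i" "i + int m \<le> int D" for i m
  proof -
    have "sublist (window u i m) (window vv 0 (length v))"
      unfolding u_def window_shiftc using that QD DQ by (intro sublist_window) auto
    then show ?thesis unfolding wv language_def by (auto simp: v_def)
  qed
  ultimately show ?thesis using d by blast
qed

text \<open>Fix an offset that recurs for infinitely many radii and take a cluster point of the
  corresponding approximate preimages.\<close>

lemma desubstitution:
  fixes \<phi> :: "'a::finite \<Rightarrow> 'a list"
  assumes cl: "constant_length k \<phi>" and k: "k \<ge> 2" and x: "x \<in> subst_shift \<phi>"
  shows "\<exists>d u. d < k \<and> u \<in> subst_shift \<phi> \<and> x = shiftc (int d) (subst_seq k \<phi> u)"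
proof -
  obtain d u where du: "\<And>D. d D < k" "\<And>D. agree D (shiftc (int (d D)) (subst_seq k \<phi> (u D))) x"
    "\<And>D i m. - int D \<le> i \<Longrightarrow> i + int m \<le> int D \<Longrightarrow> window (u D) i m \<in> language \<phi>"
    using approximate_desubstitution[OF assms] by metis
  have "finite (d ` UNIV)" by (rule finite_subset[of _ "{..<k}"]) (use du(1) in auto)
  \<comment> \<open>\<open>d0\<close> is a radius, not an offset: the recurring offset is
    \<open>d d0\<close>.\<close>
  from pigeonhole_infinite[OF infinite_UNIV_nat this] obtain d0
    where inf: "infinite {D. d D = d d0}" by auto
  obtain w where w: "\<And>E. infinite {D \<in> {D. d D = d d0}. agree E (u D) w}"
    using cluster_point_exists[OF inf, of u] by blast
  have large: "\<exists>D. D \<ge> E \<and> d D = d d0 \<and> agree E (u D) w" for E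
    using infinite_nat_iff_unbounded_le[THEN iffD1, OF w[of E], rule_format, of E] by auto
  have "w \<in> subst_shift \<phi>"
    unfolding subst_shift_iff
  proof (intro allI)
    fix i m
    obtain D where D: "D \<ge> nat \<bar>i\<bar> + m" "agree (nat \<bar>i\<bar> + m) (u D) w" using large by blast
    have "window w i m = window (u D) i m"
      by (rule window_agree[OF agree_sym[OF D(2)]]) auto
    then show "window w i m \<in> language \<phi>" using du(3)[of D i m] D(1) by simp
  qed
  moreover have "agree E x (shiftc (int (d d0)) (subst_seq k \<phi> w))" for E
  proof -
    obtain D where D: "D \<ge> E + 1" "d D = d d0" "agree (E + 1) (u D) w" using large by blast
    have "agree E (shiftc (int (d d0)) ((subst_seq k \<phi> ^^ 1) (u D)))
        (shiftc (int (d d0)) ((subst_seq k \<phi> ^^ 1) w))"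
    proof (rule agree_shiftc_funpow[OF _ _ D(3)])
      fix p :: int assume p: "\<bar>p\<bar> \<le> int E"
      have "int E \<le> int E * int k" using k mult_left_mono[of 1 "int k" "int E"] by simp
      then show "- int (E + 1) * int k \<le> p + int (d d0) \<and> p + int (d d0) < (int (E + 1) + 1) * int k"
        using p du(1)[of d0] by (auto simp: algebra_simps)
    qed (use k in auto)
    moreover have "agree E (shiftc (int (d d0)) (subst_seq k \<phi> (u D))) x"
      using agree_mono[OF du(2)[of D]] D by simp
    ultimately show ?thesis by (auto intro: agree_trans agree_sym)
  qed
  then have "x = shiftc (int (d d0)) (subst_seq k \<phi> w)" by (rule agree_all_eq)
  ultimately show ?thesis using du(1) by blast
qed

text \<open>The offsets are digits: \<open>c n\<close> is the number with base-\<open>k\<close>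
  digits \<open>d 0, ..., d (n - 1)\<close>. The relation is stated between arbitrary levels
  \<open>n\<close> and \<open>n + j\<close> because return maps compare two such levels;
  \<open>n = 0\<close> recovers \<open>x\<close>.\<close>

lemma desubstitution_chain:
  fixes \<phi> :: "'a::finite \<Rightarrow> 'a list"
  assumes cl: "constant_length k \<phi>" and k: "k \<ge> 2" and x: "x \<in> subst_shift \<phi>"
  obtains xs c where "xs 0 = x" "c 0 = 0" "\<And>n. xs n \<in> subst_shift \<phi>"
    "\<And>n j. \<exists>e. 0 \<le> e \<and> e < int k ^ j \<and> xs n = shiftc e ((subst_seq k \<phi> ^^ j) (xs (n + j))) \<and>
        c (n + j) = c n + int k ^ n * e"
proof -
  have k0: "k > 0" using k by simp
  have "\<exists>xs. \<forall>n. (xs n \<in> subst_shift \<phi> \<and> (n = 0 \<longrightarrow> xs n = x)) \<and>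
      (\<exists>d. d < k \<and> xs n = shiftc (int d) (subst_seq k \<phi> (xs (Suc n))))"
    by (rule dependent_nat_choice) (use x desubstitution[OF cl k] in blast)+
  then obtain xs where xs: "\<And>n. xs n \<in> subst_shift \<phi>" "xs 0 = x"
    "\<And>n. \<exists>d. d < k \<and> xs n = shiftc (int d) (subst_seq k \<phi> (xs (Suc n)))" by blast
  obtain d where d: "\<And>n. d n < k" "\<And>n. xs n = shiftc (int (d n)) (subst_seq k \<phi> (xs (Suc n)))"
    using xs(3) by metis
  define c where "c n = (\<Sum>i<n. int k ^ i * int (d i))" for n
  have c_Suc: "c (Suc n) = c n + int k ^ n * int (d n)" for n by (simp add: c_def)
  have "\<exists>e. 0 \<le> e \<and> e < int k ^ j \<and> xs n = shiftc e ((subst_seq k \<phi> ^^ j) (xs (n + j))) \<and>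
        c (n + j) = c n + int k ^ n * e" for n j
  proof (induction j)
    case 0
    show ?case by (intro exI[of _ 0]) simp
  next
    case (Suc j)
    then obtain e where e: "0 \<le> e" "e < int k ^ j"
      "xs n = shiftc e ((subst_seq k \<phi> ^^ j) (xs (n + j)))" "c (n + j) = c n + int k ^ n * e" by blast
    define f where "f = e + int k ^ j * int (d (n + j))"
    have "int k ^ j * (int (d (n + j)) + 1) \<le> int k ^ j * int k"
      using d(1)[of "n + j"] by (intro mult_left_mono) auto
    then have "f < int k ^ Suc j" using e(2) by (simp add: f_def algebra_simps)
    moreover have "0 \<le> f" using e(1) by (simp add: f_def)
    moreover have "xs n = shiftc f ((subst_seq k \<phi> ^^ Suc j) (xs (n + Suc j)))"
      by (subst e(3), subst d(2)) (simp add: funpow_subst_seq_shiftc[OF k0] shiftc_shiftc f_def funpow_swap[of j _ 1, simplified])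
    moreover have "c (n + Suc j) = c n + int k ^ n * f"
      using e(4) c_Suc[of "n + j"] by (simp add: f_def algebra_simps power_add)
    ultimately show ?case by blast
  qed
  moreover have "c 0 = 0" by (simp add: c_def)
  ultimately show ?thesis using that[of xs c] xs(1,2) by blast
qed

section \<open>Factor maps as sliding block codes\<close>

text \<open>The local rule takes a whole sequence, and its finite radius is a separate assumption
  \<open>agree R u v \<Longrightarrow> G u = G v\<close>. The code is thus defined on all sequences,
  including those outside the substitution shift.\<close>

definition slide :: "((int \<Rightarrow> 'a) \<Rightarrow> 'b) \<Rightarrow> (int \<Rightarrow> 'a) \<Rightarrow> int \<Rightarrow> 'b" where
  "slide G u = (\<lambda>p. G (shiftc p u))"

lemma slide_shiftc: "slide G (shiftc c u) = shiftc c (slide G u)"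
  by (simp add: slide_def shiftc_def algebra_simps)

text \<open>The set where the letter at 0 equals \<open>\<pi> z 0\<close> is open, hence contains a
  cylinder around \<open>z\<close>, which constrains finitely many coordinates.\<close>

lemma continuous_map_locally_constant:
  assumes cont: "continuous_map (subtopology seq_top X) (subtopology seq_top Y) \<pi>" and z: "z \<in> X"
  shows "\<exists>D. \<forall>u\<in>X. agree D u z \<longrightarrow> \<pi> u 0 = \<pi> z 0"
proof -
  have cont0: "continuous_map (subtopology seq_top X) (discrete_topology UNIV) (\<lambda>u. \<pi> u 0)"
    using cont unfolding continuous_map_in_subtopology seq_top_def continuous_map_componentwise_UNIV
    by blast
  have "openin (subtopology seq_top X) {u \<in> topspace (subtopology seq_top X). \<pi> u 0 \<in> {\<pi> z 0}}"
    by (rule openin_continuous_map_preimage[OF cont0]) simp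
  then obtain W where W: "openin seq_top W" "{u \<in> X. \<pi> u 0 = \<pi> z 0} = W \<inter> X"
    by (auto simp: openin_subtopology seq_top_def)
  have "z \<in> W" using W z by auto
  then obtain U where U: "finite {i. U i \<noteq> UNIV}" "z \<in> PiE UNIV U" "PiE UNIV U \<subseteq> W"
    using W(1) unfolding seq_top_def openin_product_topology_alt by auto
  \<comment> \<open>Inserting 0 keeps \<open>Max\<close> meaningful when no coordinate is
    constrained.\<close>
  define D where "D = nat (Max (insert 0 (abs ` {i. U i \<noteq> UNIV})))"
  have D: "\<bar>i\<bar> \<le> int D" if "U i \<noteq> UNIV" for i
    unfolding D_def using U(1) that by (subst int_nat_eq) (auto intro!: Max_ge simp: not_le)
  have "\<pi> u 0 = \<pi> z 0" if u: "u \<in> X" "agree D u z" for u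
  proof -
    have "u i \<in> U i" for i
    proof (cases "U i = UNIV")
      case False
      then have "u i = z i" using agreeD[OF u(2)] D by blast
      then show ?thesis using U(2) by auto
    qed simp
    then have "u \<in> W" using U(3) by auto
    then show ?thesis using W(2) u(1) by blast
  qed
  then show ?thesis by blast
qed

text \<open>The Curtis-Hedlund-Lyndon theorem. If no radius worked for all points, the bad pairs
  would accumulate at some \<open>z\<close>, against local constancy at \<open>z\<close>.\<close>

lemma factor_map_is_slide:
  fixes \<phi> :: "'a::finite \<Rightarrow> 'a list"
  assumes fm: "factor_map (subst_shift \<phi>) Y \<pi>"
  obtains G R where "\<And>u v. agree R u v \<Longrightarrow> G u = G v"
    "\<And>x. x \<in> subst_shift \<phi> \<Longrightarrow> \<pi> x = slide G x"
proof -
  let ?X = "subst_shift \<phi>"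
  have cont: "continuous_map (subtopology seq_top ?X) (subtopology seq_top Y) \<pi>"
    and sh: "\<And>x. x \<in> ?X \<Longrightarrow> \<pi> (shiftc 1 x) = shiftc 1 (\<pi> x)"
    using fm by (auto simp: factor_map_def shift_def)
  have "\<exists>R. \<forall>u\<in>?X. \<forall>v\<in>?X. agree R u v \<longrightarrow> \<pi> u 0 = \<pi> v 0"
  proof (rule ccontr)
    assume "\<not> ?thesis"
    then obtain u v where uv: "\<And>R. u R \<in> ?X" "\<And>R. v R \<in> ?X" "\<And>R. agree R (u R) (v R)"
      "\<And>R. \<pi> (u R) 0 \<noteq> \<pi> (v R) 0" by metis
    obtain z where z: "\<And>D. infinite {M \<in> UNIV. agree D (u M) z}"
      using cluster_point_exists[OF infinite_UNIV_nat, of u] by blast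
    have large: "\<exists>M. M \<ge> D \<and> agree D (u M) z" for D
      using infinite_nat_iff_unbounded_le[THEN iffD1, OF z[of D], rule_format, of D] by auto
    have "z \<in> ?X"
      by (rule subst_shift_closed) (use large uv(1) agree_sym in blast)
    then obtain D where D: "\<And>u. u \<in> ?X \<Longrightarrow> agree D u z \<Longrightarrow> \<pi> u 0 = \<pi> z 0"
      using continuous_map_locally_constant[OF cont] by blast
    obtain M where M: "M \<ge> D" "agree D (u M) z" using large by blast
    have "agree D (v M) z" using agree_mono[OF uv(3) M(1)] M(2) agree_sym agree_trans by blast
    then have "\<pi> (u M) 0 = \<pi> (v M) 0" using D M(2) uv(1,2) by metis
    then show False using uv(4) by blast
  qed
  then obtain R where R: "\<And>u v. u \<in> ?X \<Longrightarrow> v \<in> ?X \<Longrightarrow> agree R u v \<Longrightarrow> \<pi> u 0 = \<pi> v 0" by blast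
  have sh_nat: "\<pi> (shiftc (int n) x) = shiftc (int n) (\<pi> x)" if "x \<in> ?X" for n x
  proof (induction n)
    case (Suc n)
    have "\<pi> (shiftc 1 (shiftc (int n) x)) = shiftc 1 (\<pi> (shiftc (int n) x))"
      using that by (intro sh shiftc_in_subst_shift)
    then show ?case using Suc by (simp add: shiftc_shiftc)
  qed simp
  have sh_int: "\<pi> (shiftc c x) = shiftc c (\<pi> x)" if x: "x \<in> ?X" for c x
  proof (cases "c \<ge> 0")
    case True
    then show ?thesis using sh_nat[OF x, of "nat c"] by simp
  next
    case False
    have "shiftc c (\<pi> (shiftc (int (nat (- c))) (shiftc c x))) = shiftc c (shiftc (- c) (\<pi> (shiftc c x)))"
      using False sh_nat[OF shiftc_in_subst_shift[OF x, of c], of "nat (- c)"] by simp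
    then show ?thesis using False by (simp add: shiftc_shiftc)
  qed
  \<comment> \<open>The choice depends on \<open>u\<close> only through its window of radius
    \<open>R\<close>, so \<open>G\<close> is local even where no point of the subshift shows that
    window.\<close>
  define G where "G u = \<pi> (SOME x. x \<in> ?X \<and> agree R u x) 0" for u
  have "G u = G v" if "agree R u v" for u v
  proof -
    have "agree R u x \<longleftrightarrow> agree R v x" for x using that by (auto simp: agree_def)
    then show ?thesis by (simp add: G_def)
  qed
  moreover have "\<pi> x = slide G x" if x: "x \<in> ?X" for x
  proof
    fix p
    have "\<exists>v. v \<in> ?X \<and> agree R (shiftc p x) v"
      using shiftc_in_subst_shift[OF x] by (auto simp: agree_def)
    from someI_ex[OF this] R[of "shiftc p x"] shiftc_in_subst_shift[OF x, of p]
    have "\<pi> (shiftc p x) 0 = G (shiftc p x)" unfolding G_def by blast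
    then show "\<pi> x p = slide G x p"
      using sh_int[OF x, of p] by (simp add: slide_def) (simp add: shiftc_def)
  qed
  ultimately show ?thesis using that by blast
qed

section \<open>Finiteness of the family of fibres over an automatic sequence\<close>

text \<open>As \<open>R \<le> n < k ^ n\<close>, a window of radius \<open>R\<close> around a
  position of block \<open>i\<close> meets only the blocks \<open>i - 1\<close>, \<open>i\<close>
  and \<open>i + 1\<close>.\<close>

lemma slide_funpow_block:
  assumes k: "k \<ge> 2" and loc: "\<And>u v. agree R u v \<Longrightarrow> G u = G v"
    and n: "R \<le> n" and r: "0 \<le> r" "r < int k ^ n"
    and t: "t (-1) = u (i - 1)" "t 0 = u i" "t 1 = u (i + 1)"
  shows "slide G ((subst_seq k \<phi> ^^ n) u) (int k ^ n * i + r) = slide G ((subst_seq k \<phi> ^^ n) t) r"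
proof -
  have k0: "k > 0" using k by simp
  let ?K = "int k ^ n"
  have K0: "?K > 0" using k0 by simp
  have "int R < int (k ^ n)" using order.strict_trans1[OF n order.strict_trans2[OF less_exp[of n] power_mono[of 2 k n]]] k by simp
  then have RK: "int R < ?K" by simp
  show ?thesis
    unfolding slide_def
  proof (rule loc, unfold agree_def, intro allI impI)
    fix q assume q: "\<bar>q\<bar> \<le> int R"
    have eq: "q + (?K * i + r) = (q + r) + ?K * i" by simp
    have "- ?K \<le> q + r" "q + r < 2 * ?K" using q r RK by linarith+
    then have "-1 \<le> (q + r) div ?K" "(q + r) div ?K < 2"
      using int_le_div_iff[OF K0, of "-1" "q + r"] int_div_less_iff[OF K0, of "q + r" 2] by auto
    then have "(q + r) div ?K \<in> {-1, 0, 1}" by auto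
    then have "u (i + (q + r) div ?K) = t ((q + r) div ?K)" using t by auto
    then show "shiftc (?K * i + r) ((subst_seq k \<phi> ^^ n) u) q = shiftc r ((subst_seq k \<phi> ^^ n) t) q"
      using K0 by (simp add: shiftc_def funpow_subst_seq[OF k0] eq add.commute[of i])
  qed
qed

text \<open>The \<open>n\<close>-th fibre is cut out by a condition on the triples \<open>(u (i - 1), u i, u (i + 1))\<close> that
  involves \<open>y\<close> only through the letters \<open>w (i - 1)\<close> and \<open>w i\<close> of a fixed point \<open>w\<close> coding \<open>y\<close>; hence
  it is determined by a subset of a finite set that does not depend on \<open>n\<close>.\<close>

lemma finitely_many_fibres:
  fixes \<phi> :: "'a::finite \<Rightarrow> 'a list"
  assumes k: "k \<ge> 2" and aut: "automatic k y" and loc: "\<And>u v. agree R u v \<Longrightarrow> G u = G v"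
    and c: "\<And>n. 0 \<le> c n" "\<And>n. c n < int k ^ n"
  shows "finite ((\<lambda>n. {u. slide G (shiftc (c n) ((subst_seq k \<phi> ^^ n) u)) = y}) ` {R..})"
proof -
  have k0: "k > 0" using k by simp
  obtain C :: "nat set" and \<sigma> w \<tau> where C: "finite C" "range w \<subseteq> C" "subst_seq k \<sigma> w = w" "y = \<tau> \<circ> w"
    using aut unfolding automatic_def by blast
  have w: "w p = iterate_letter k \<sigma> n (p mod int k ^ n) (w (p div int k ^ n))" for n p
  proof -
    have "(subst_seq k \<sigma> ^^ n) w = w" by (induction n) (simp_all add: C(3))
    then show ?thesis using funpow_subst_seq[OF k0, of n \<sigma> w p] by simp
  qed
  define t where "t a b a' = (\<lambda>p::int. if p < 0 then a else if p = 0 then b else a')" for a b a' :: 'a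
  \<comment> \<open>A triple is paired with two letters of \<open>w\<close> when the block of length
    \<open>k ^ n\<close> coded from the triple matches the stretch of \<open>y\<close> that these
    two letters describe.\<close>
  define S where "S n = {((a, b, a'), (s, s')). s \<in> C \<and> s' \<in> C \<and>
      (\<forall>r. 0 \<le> r \<and> r < int k ^ n \<longrightarrow> slide G ((subst_seq k \<phi> ^^ n) (t a b a')) r =
        \<tau> (iterate_letter k \<sigma> n ((r - c n) mod int k ^ n) (if c n \<le> r then s' else s)))}" for n
  have "finite (range S)"
  proof (rule finite_subset)
    show "range S \<subseteq> Pow (UNIV \<times> (C \<times> C))" by (auto simp: S_def)
    show "finite (Pow ((UNIV :: ('a \<times> 'a \<times> 'a) set) \<times> (C \<times> C)))" using C(1) by simp
  qed
  moreover have "{u. slide G (shiftc (c n) ((subst_seq k \<phi> ^^ n) u)) = y} =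
      {u. \<forall>i. ((u (i - 1), u i, u (i + 1)), (w (i - 1), w i)) \<in> S n}" (is "?L = ?R") if n: "R \<le> n" for n
  proof -
    let ?K = "int k ^ n"
    have K0: "?K > 0" using k0 by simp
    have yb: "y (?K * i + r - c n) =
        \<tau> (iterate_letter k \<sigma> n ((r - c n) mod ?K) (if c n \<le> r then w i else w (i - 1)))"
      if r: "0 \<le> r" "r < ?K" for i r
    proof -
      have eq: "?K * i + r - c n = (r - c n) + ?K * i" by simp
      \<comment> \<open>Since \<open>0 \<le> c n < ?K\<close>, subtracting \<open>c n\<close>
        crosses at most one block boundary.\<close>
      have "w (i + (r - c n) div ?K) = (if c n \<le> r then w i else w (i - 1))"
      proof (cases "c n \<le> r")
        case True
        then show ?thesis using r c(1)[of n] by (simp add: div_pos_pos_trivial)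
      next
        case False
        have "-1 \<le> (r - c n) div ?K" using r c(2)[of n] int_le_div_iff[OF K0, of "-1"] by simp
        moreover have "(r - c n) div ?K < 0" using False K0 by (simp add: div_neg_pos_less0)
        ultimately have "(r - c n) div ?K = -1" by simp
        then show ?thesis using False by simp
      qed
      then show ?thesis
        using C(4) w[of "?K * i + r - c n" n] K0 by (simp add: eq add.commute[of i])
    qed
    have gb: "slide G (shiftc (c n) ((subst_seq k \<phi> ^^ n) u)) (?K * i + r - c n) =
        slide G ((subst_seq k \<phi> ^^ n) (t (u (i - 1)) (u i) (u (i + 1)))) r"
      if r: "0 \<le> r" "r < ?K" for u i r
    proof -
      have "slide G ((subst_seq k \<phi> ^^ n) u) (?K * i + r) =
        slide G ((subst_seq k \<phi> ^^ n) (t (u (i - 1)) (u i) (u (i + 1)))) r"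
        by (rule slide_funpow_block[OF k loc n r]) (simp_all add: t_def)
      then show ?thesis by (simp add: slide_shiftc) (simp add: shiftc_def)
    qed
    have "slide G (shiftc (c n) ((subst_seq k \<phi> ^^ n) u)) = y \<longleftrightarrow>
        (\<forall>i r. 0 \<le> r \<and> r < ?K \<longrightarrow>
          slide G (shiftc (c n) ((subst_seq k \<phi> ^^ n) u)) (?K * i + r - c n) = y (?K * i + r - c n))" for u
    proof
      assume *: "\<forall>i r. 0 \<le> r \<and> r < ?K \<longrightarrow>
          slide G (shiftc (c n) ((subst_seq k \<phi> ^^ n) u)) (?K * i + r - c n) = y (?K * i + r - c n)"
      show "slide G (shiftc (c n) ((subst_seq k \<phi> ^^ n) u)) = y"
      proof
        fix p
        have "?K * ((p + c n) div ?K) + (p + c n) mod ?K - c n = p" by simp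
        then show "slide G (shiftc (c n) ((subst_seq k \<phi> ^^ n) u)) p = y p"
          using *[rule_format, of "(p + c n) mod ?K" "(p + c n) div ?K"] K0 by simp
      qed
    qed simp
    then have "u \<in> ?L \<longleftrightarrow> u \<in> ?R" for u
      unfolding mem_Collect_eq using C(2) by (auto simp: gb yb S_def)
    then show ?thesis by blast
  qed
  then have "(\<lambda>n. {u. slide G (shiftc (c n) ((subst_seq k \<phi> ^^ n) u)) = y}) ` {R..} \<subseteq>
      (\<lambda>P. {u. \<forall>i. ((u (i - 1), u i, u (i + 1)), (w (i - 1), w i)) \<in> P}) ` range S" by auto
  ultimately show ?thesis by (meson finite_imageI finite_subset)
qed

section \<open>Periodicity, and automaticity of images of quasi-fixed points\<close>

lemma periodic_if_shiftc_eq: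
  assumes "shiftc d y = y" "d \<noteq> 0"
  shows "periodic y"
proof -
  have pow: "(shift ^^ p) y = shiftc (int p) y" for p
    by (induction p) (simp_all add: shift_def shiftc_shiftc)
  have "shiftc (- d) y = y" by (subst assms(1)[symmetric]) (simp add: shiftc_shiftc)
  then have "shiftc (int (nat \<bar>d\<bar>)) y = y" using assms(1) by (cases "d \<ge> 0") simp_all
  then show ?thesis unfolding periodic_def using pow assms(2) by (intro exI[of _ "nat \<bar>d\<bar>"]) auto
qed

text \<open>The values of \<open>v\<close> serve as letters: by \<open>step\<close> the block of
  \<open>v\<close> at \<open>k * i\<close> is a function of \<open>v i\<close>, so \<open>v\<close>
  is a fixed point of a substitution of length \<open>k\<close>. The injection \<open>enc\<close>
  supplies the natural-number alphabet required by \<open>automatic\<close>.\<close>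

lemma automaticI:
  fixes v :: "int \<Rightarrow> 'c" and y :: "int \<Rightarrow> 'b"
  assumes k: "k > 0" and fin: "finite (range v)"
    and step: "\<And>i j r. v i = v j \<Longrightarrow> 0 \<le> r \<Longrightarrow> r < int k \<Longrightarrow> v (int k * i + r) = v (int k * j + r)"
    and y: "\<And>i j. v i = v j \<Longrightarrow> y i = y j"
  shows "automatic k y"
proof -
  obtain enc :: "'c \<Rightarrow> nat" where enc: "inj_on enc (range v)"
    using finite_imp_inj_to_nat_seg[OF fin] by metis
  define w where "w i = enc (v i)" for i
  define pos where "pos a = (SOME i. w i = a)" for a
  define \<sigma> where "\<sigma> a = window w (int k * pos a) k" for a
  have "w (pos (w i)) = w i" for i unfolding pos_def by (rule someI) simp
  then have pos: "v (pos (w i)) = v i" for i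
    using enc unfolding w_def inj_on_def by blast
  have "subst_seq k \<sigma> w p = w p" for p
  proof -
    have r: "0 \<le> p mod int k" "p mod int k < int k" using k by auto
    have "\<sigma> (w (p div int k)) ! nat (p mod int k) = w (int k * pos (w (p div int k)) + p mod int k)"
      unfolding \<sigma>_def using r by (subst nth_window) auto
    also have "\<dots> = w (int k * (p div int k) + p mod int k)"
      unfolding w_def using step[OF pos[of "p div int k"] r] by (simp add: w_def)
    also have "\<dots> = w p" by simp
    finally show ?thesis by (simp add: subst_seq_def)
  qed
  then have "subst_seq k \<sigma> w = w" by blast
  moreover have "finite (range w)"
    using finite_imageI[OF fin, of enc] by (simp add: w_def image_image)
  moreover have "y = (\<lambda>a. y (pos a)) \<circ> w"
    using y[OF pos] by (auto simp: fun_eq_iff)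
  moreover have "\<forall>a\<in>range w. length (\<sigma> a) = k \<and> set (\<sigma> a) \<subseteq> range w"
    by (auto simp: \<sigma>_def) (auto simp: window_def)
  ultimately show ?thesis unfolding automatic_def by blast
qed

text \<open>The equation for \<open>x\<close> has length \<open>k ^ m\<close>, whereas a
  substitution of length \<open>k\<close> is wanted; the state \<open>v i\<close> therefore records
  \<open>x\<close> at all intermediate scales \<open>k ^ t\<close> with
  \<open>t < m\<close>.\<close>

lemma automatic_slide_quasi_fixed:
  fixes x :: "int \<Rightarrow> 'a::finite"
  assumes k: "k \<ge> 2" and loc: "\<And>u v. agree R u v \<Longrightarrow> G u = G v" and qf: "quasi_fixed k \<phi> x"
  shows "automatic k (slide G x)"
proof -
  have k0: "k > 0" using k by simp
  obtain m c where m: "m \<ge> 1" "shiftc c ((subst_seq k \<phi> ^^ m) x) = x"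
    using qf by (auto simp: quasi_fixed_def)
  let ?K = "int k ^ m"
  have "k ^ 1 \<le> k ^ m" using k m(1) by (intro power_increasing) auto
  then have "2 \<le> k ^ m" using k by simp
  then have K2: "?K \<ge> 2" by (metis of_nat_le_iff of_nat_numeral of_nat_power)
  then have K0: "?K > 0" by linarith
  \<comment> \<open>The radius covers the window of \<open>G\<close> and reproduces itself:
    \<open>\<bar>d\<bar> + \<bar>c\<bar> \<le> 2 * D \<le> D * ?K\<close>, so dividing by
    \<open>?K\<close> leads back into \<open>[-D, D]\<close>.\<close>
  define D where "D = int R + \<bar>c\<bar> + 2"
  define I where "I = (SIGMA t:{..<m}. {0..<int k ^ t} \<times> {-D..D})"
  define v where "v i = restrict (\<lambda>(t, s, d). x (int k ^ t * i + s + d)) I" for i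
  have vD: "x (int k ^ t * i + s + d) = x (int k ^ t * j + s + d)"
    if "v i = v j" "t < m" "0 \<le> s" "s < int k ^ t" "\<bar>d\<bar> \<le> D" for i j t s d
  proof -
    have "(t, s, d) \<in> I" using that by (auto simp: I_def)
    then show ?thesis using fun_cong[OF that(1), of "(t, s, d)"] by (simp add: v_def)
  qed
  have x0: "x (i + d) = x (j + d)" if "v i = v j" "\<bar>d\<bar> \<le> D" for i j d
    using vD[OF that(1), of 0 0 d] that(2) m(1) by simp
  show ?thesis
  proof (rule automaticI[OF k0, of v])
    have "finite I" unfolding I_def by (intro finite_SigmaI finite_cartesian_product) auto
    then have "finite (PiE I (\<lambda>_. UNIV :: 'a set))" by (intro finite_PiE) auto
    moreover have "range v \<subseteq> PiE I (\<lambda>_. UNIV)"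
      unfolding v_def by (intro image_subsetI restrict_PiE_iff[THEN iffD2]) simp
    ultimately show "finite (range v)" by (rule finite_subset[rotated])
  next
    fix i j r assume ij: "v i = v j" and r: "0 \<le> r" "r < int k"
    show "v (int k * i + r) = v (int k * j + r)"
      unfolding v_def
    proof (rule restrict_ext, clarify)
      fix t s d assume "(t, s, d) \<in> I"
      then have t: "t < m" and s: "0 \<le> s" "s < int k ^ t" and d: "\<bar>d\<bar> \<le> D"
        by (auto simp: I_def)
      \<comment> \<open>Scale \<open>t\<close> at \<open>k * i + r\<close> is scale
        \<open>Suc t\<close> at \<open>i\<close> with offset \<open>s'\<close>; when
        \<open>Suc t = m\<close>, the equation for \<open>x\<close> leads back to scale 0.\<close>
      define s' where "s' = int k ^ t * r + s"
      have eq: "int k ^ t * (int k * i + r) + s + d = int k ^ Suc t * i + s' + d" for i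
        by (simp add: s'_def algebra_simps)
      have "int k ^ t * (r + 1) \<le> int k ^ t * int k" using r by (intro mult_left_mono) auto
      then have s': "0 \<le> s'" "s' < int k ^ Suc t"
        using s r by (auto simp: s'_def algebra_simps)
      show "x (int k ^ t * (int k * i + r) + s + d) = x (int k ^ t * (int k * j + r) + s + d)"
      proof (cases "Suc t < m")
        case True
        then show ?thesis unfolding eq by (rule vD[OF ij _ s' d])
      next
        case False
        then have mt: "Suc t = m" using t by simp
        let ?q = "s' + d + c"
        have x_eq: "x (?K * i + s' + d) = iterate_letter k \<phi> m (?q mod ?K) (x (i + ?q div ?K))" for i
        proof -
          have "x (?K * i + s' + d) = (subst_seq k \<phi> ^^ m) x (?K * i + s' + d + c)"
            by (subst m(2)[symmetric]) (simp add: shiftc_def)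
          also have "?K * i + s' + d + c = ?q + ?K * i" by simp
          finally show ?thesis using K0 by (simp add: funpow_subst_seq[OF k0] add.commute[of i])
        qed
        have DK: "D * 2 \<le> D * ?K" using K2 by (intro mult_left_mono) (auto simp: D_def)
        have "- (D * ?K) \<le> ?q" using DK s' d D_def by linarith
        then have "- D \<le> ?q div ?K" using int_le_div_iff[OF K0, of "- D" ?q] by simp
        moreover have "?q < (D + 1) * ?K" using DK s' d unfolding mt by (simp add: D_def algebra_simps)
        then have "?q div ?K < D + 1" using int_div_less_iff[OF K0] by blast
        ultimately have "\<bar>?q div ?K\<bar> \<le> D" by linarith
        then show ?thesis unfolding eq mt x_eq by (simp add: x0[OF ij])
      qed
    qed
  next
    fix i j assume ij: "v i = v j"
    show "slide G x i = slide G x j"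
      unfolding slide_def
      by (rule loc) (use x0[OF ij] in \<open>auto simp: agree_def shiftc_def D_def add.commute\<close>)
  qed
qed

section \<open>Return maps and quasi-fixed preimages\<close>

text \<open>\<open>J\<close> collects the gaps between a level \<open>n\<close> and later levels
  with the same fibre and the same three central letters. Equal fibres make the return maps preserve
  the fibre; equal central letters, with \<open>0 \<le> e j < k ^ j\<close>, yield agreement with
  \<open>z\<close> up to radius \<open>k ^ j\<close>.\<close>

lemma return_maps:
  fixes \<phi> :: "'a::finite \<Rightarrow> 'a list"
  assumes cl: "constant_length k \<phi>" and k: "k \<ge> 2" and x: "x \<in> subst_shift \<phi>"
    and loc: "\<And>u v. agree R u v \<Longrightarrow> G u = G v" and aut: "automatic k y" and y: "slide G x = y"
  obtains z c n J e where "z \<in> subst_shift \<phi>" "x = shiftc c ((subst_seq k \<phi> ^^ n) z)"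
    "infinite J" "\<And>j. j \<in> J \<Longrightarrow> j \<ge> 1" "\<And>j. j \<in> J \<Longrightarrow> 0 \<le> e j \<and> e j < int k ^ j"
    "\<And>j u. j \<in> J \<Longrightarrow> slide G (shiftc c ((subst_seq k \<phi> ^^ n) u)) = y \<Longrightarrow>
      slide G (shiftc c ((subst_seq k \<phi> ^^ n) (shiftc (e j) ((subst_seq k \<phi> ^^ j) u)))) = y"
    "\<And>j u. j \<in> J \<Longrightarrow> agree 1 u z \<Longrightarrow> agree (k ^ j) (shiftc (e j) ((subst_seq k \<phi> ^^ j) u)) z"
proof -
  have k0: "k > 0" using k by simp
  obtain xs c where xs: "xs 0 = x" "c 0 = 0" "\<And>n. xs n \<in> subst_shift \<phi>"
    "\<And>n j. \<exists>e. 0 \<le> e \<and> e < int k ^ j \<and> xs n = shiftc e ((subst_seq k \<phi> ^^ j) (xs (n + j))) \<and>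
        c (n + j) = c n + int k ^ n * e"
    by (rule desubstitution_chain[OF cl k x]) blast
  have c: "0 \<le> c n" "c n < int k ^ n" "x = shiftc (c n) ((subst_seq k \<phi> ^^ n) (xs n))" for n
    using xs(4)[of n 0] xs(1,2) by auto
  define V where "V n = {u. slide G (shiftc (c n) ((subst_seq k \<phi> ^^ n) u)) = y}" for n
  have finV: "finite (V ` {R..})"
    unfolding V_def by (rule finitely_many_fibres[OF k aut loc c(1,2)])
  \<comment> \<open>Three letters suffice: a position in \<open>[-k ^ j, k ^ j]\<close> shifted by
    \<open>e j\<close> stays in the blocks \<open>-1\<close>, \<open>0\<close> and
    \<open>1\<close>.\<close>
  define f where "f n = (V n, xs n (-1), xs n 0, xs n 1)" for n
  have "finite (f ` {R..})"
    by (rule finite_subset[of _ "V ` {R..} \<times> UNIV"]) (use finV in \<open>auto simp: f_def\<close>)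
  from pigeonhole_infinite[OF infinite_Ici this] obtain n
    where inf: "infinite {m \<in> {R..}. f m = f n}" by blast
  define J where "J = {j. j \<ge> 1 \<and> f (n + j) = f n}"
  have "{m \<in> {R..}. f m = f n} \<subseteq> {..n} \<union> (\<lambda>j. n + j) ` J"
  proof
    fix m assume m: "m \<in> {m \<in> {R..}. f m = f n}"
    show "m \<in> {..n} \<union> (\<lambda>j. n + j) ` J"
    proof (cases "m \<le> n")
      case False
      then have "m - n \<in> J" "m = n + (m - n)" using m by (auto simp: J_def)
      then show ?thesis by blast
    qed simp
  qed
  with inf have "infinite ({..n} \<union> (\<lambda>j. n + j) ` J)" using infinite_super by blast
  then have infJ: "infinite J" by auto
  have "\<forall>j. \<exists>e. 0 \<le> e \<and> e < int k ^ j \<and> xs n = shiftc e ((subst_seq k \<phi> ^^ j) (xs (n + j))) \<and>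
      c (n + j) = c n + int k ^ n * e" using xs(4) by blast
  from choice[OF this] obtain e where e: "\<And>j. 0 \<le> e j" "\<And>j. e j < int k ^ j"
    "\<And>j. xs n = shiftc (e j) ((subst_seq k \<phi> ^^ j) (xs (n + j)))"
    "\<And>j. c (n + j) = c n + int k ^ n * e j"
    by blast
  show ?thesis
  proof (rule that[of "xs n" "c n" n J e])
    fix j u assume j: "j \<in> J" and u: "slide G (shiftc (c n) ((subst_seq k \<phi> ^^ n) u)) = y"
    have "u \<in> V n" using u by (simp add: V_def)
    then have "u \<in> V (n + j)" using j by (simp add: J_def f_def)
    then show "slide G (shiftc (c n) ((subst_seq k \<phi> ^^ n) (shiftc (e j) ((subst_seq k \<phi> ^^ j) u)))) = y"
      by (simp add: V_def funpow_subst_seq_shiftc[OF k0] shiftc_shiftc e(4) funpow_add)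
  next
    fix j u assume j: "j \<in> J" and u: "agree 1 u (xs n)"
    have "\<bar>p\<bar> \<le> int 1 \<longleftrightarrow> p = -1 \<or> p = 0 \<or> p = 1" for p by auto
    then have "agree 1 (xs n) (xs (n + j))" using j unfolding agree_def J_def f_def by auto
    then have "agree 1 u (xs (n + j))" using u agree_trans by blast
    then show "agree (k ^ j) (shiftc (e j) ((subst_seq k \<phi> ^^ j) u)) (xs n)"
      unfolding e(3)[of j]
      by (rule agree_shiftc_funpow[OF k0 refl]) (use e(1,2)[of j] in auto)
  qed (use xs(3) c(3) infJ e(1,2) in \<open>auto simp: J_def\<close>)
qed

text \<open>Each application enlarges the radius on which consecutive iterates of \<open>z\<close>
  agree, so a cluster point of the iterates is fixed, and it lies in the closed invariant set
  \<open>V\<close>.\<close>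

lemma fixed_point_of_return_map:
  fixes \<phi> :: "'a::finite \<Rightarrow> 'a list"
  assumes k: "k \<ge> 2" and j: "j \<ge> 1" and e: "0 \<le> e" "e < int k ^ j"
    and z: "agree 1 (shiftc e ((subst_seq k \<phi> ^^ j) z)) z" "z \<in> V"
    and V: "\<And>u. u \<in> V \<Longrightarrow> shiftc e ((subst_seq k \<phi> ^^ j) u) \<in> V"
    and closed: "\<And>u. (\<And>D. \<exists>v\<in>V. agree D u v) \<Longrightarrow> u \<in> V"
  shows "\<exists>u\<in>V. shiftc e ((subst_seq k \<phi> ^^ j) u) = u"
proof -
  have k0: "k > 0" using k by simp
  define \<Psi> where "\<Psi> u = shiftc e ((subst_seq k \<phi> ^^ j) u)" for u
  have "k ^ 1 \<le> k ^ j" using k j by (intro power_increasing) auto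
  then have "2 \<le> k ^ j" using k by simp
  then have K2: "int k ^ j \<ge> 2" by (metis of_nat_le_iff of_nat_numeral of_nat_power)
  \<comment> \<open>Growth starts at radius 1, where \<open>D + 1 \<le> 2 * D\<close>; for
    \<open>e = 0\<close> the letter at 0 does not determine position \<open>-1\<close> of the
    image.\<close>
  have expand: "agree (Suc D) (\<Psi> u) (\<Psi> v)" if "agree D u v" "D \<ge> 1" for D u v
    unfolding \<Psi>_def
  proof (rule agree_shiftc_funpow[OF k0 refl that(1)])
    fix p assume p: "\<bar>p\<bar> \<le> int (Suc D)"
    have "int D * 2 \<le> int D * int k ^ j" using K2 by (intro mult_left_mono) auto
    then show "- int D * int k ^ j \<le> p + e \<and> p + e < (int D + 1) * int k ^ j"
      unfolding distrib_right minus_mult_left[symmetric] mult_1 using p e that(2) by linarith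
  qed
  define zs where "zs l = (\<Psi> ^^ l) z" for l
  have zsV: "zs l \<in> V" for l by (induction l) (use z(2) V in \<open>auto simp: zs_def \<Psi>_def\<close>)
  have zs_agree: "agree (Suc l) (\<Psi> (zs l)) (zs l)" for l
  proof (induction l)
    case 0
    show ?case using z(1) by (simp add: zs_def \<Psi>_def)
  next
    case (Suc l)
    from expand[OF Suc] show ?case by (simp add: zs_def)
  qed
  obtain u where u: "\<And>D. infinite {l \<in> UNIV. agree D (zs l) u}"
    using cluster_point_exists[OF infinite_UNIV_nat, of zs] by blast
  have large: "\<exists>l. l \<ge> D \<and> agree D (zs l) u" for D
    using infinite_nat_iff_unbounded_le[THEN iffD1, OF u[of D], rule_format, of D] by auto
  have "u \<in> V"
    by (rule closed) (use large zsV agree_sym in blast)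
  moreover have "agree D (\<Psi> u) u" for D
  proof -
    obtain l where l: "l \<ge> Suc D" "agree (Suc D) (zs l) u" using large by blast
    have "agree D (\<Psi> u) (\<Psi> (zs l))"
      using expand[OF agree_sym[OF l(2)]] by (auto intro: agree_mono)
    moreover have "agree D (\<Psi> (zs l)) (zs l)" using zs_agree[of l] l(1) by (auto intro: agree_mono)
    moreover have "agree D (zs l) u" using l(2) by (auto intro: agree_mono)
    ultimately show ?thesis by (meson agree_trans)
  qed
  then have "\<Psi> u = u" by (rule agree_all_eq)
  ultimately show ?thesis unfolding \<Psi>_def by blast
qed

lemma fibre_closed:
  assumes k: "k > 0" and loc: "\<And>u v. agree R u v \<Longrightarrow> G u = G v"
    and approx: "\<And>D. \<exists>v. slide G (shiftc c ((subst_seq k \<phi> ^^ n) v)) = y \<and> agree D u v"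
  shows "slide G (shiftc c ((subst_seq k \<phi> ^^ n) u)) = y"
proof
  fix p
  define E where "E = nat (\<bar>p\<bar> + int R + \<bar>c\<bar>)"
  obtain v where v: "slide G (shiftc c ((subst_seq k \<phi> ^^ n) v)) = y" "agree E u v"
    using approx by blast
  have K: "1 \<le> int k ^ n" using k by simp
  have "agree R (shiftc (p + c) ((subst_seq k \<phi> ^^ n) u)) (shiftc (p + c) ((subst_seq k \<phi> ^^ n) v))"
  proof (rule agree_shiftc_funpow[OF k refl v(2)])
    fix q assume q: "\<bar>q\<bar> \<le> int R"
    have "int E * 1 \<le> int E * int k ^ n" using K by (intro mult_left_mono) auto
    moreover have "\<bar>q + (p + c)\<bar> \<le> int E" using q by (auto simp: E_def)
    ultimately show "- int E * int k ^ n \<le> q + (p + c) \<and> q + (p + c) < (int E + 1) * int k ^ n"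
      unfolding distrib_right minus_mult_left[symmetric] mult_1 using K by linarith
  qed
  from loc[OF this] show "slide G (shiftc c ((subst_seq k \<phi> ^^ n) u)) p = y p"
    unfolding v(1)[symmetric] by (simp add: slide_def shiftc_shiftc)
qed

text \<open>A single return map suffices. Its invariant set is the fibre intersected with the
  substitution shift, which keeps the fixed point inside the latter.\<close>

lemma quasi_fixed_preimage_exists:
  fixes \<phi> :: "'a::finite \<Rightarrow> 'a list"
  assumes cl: "constant_length k \<phi>" and k: "k \<ge> 2" and x: "x \<in> subst_shift \<phi>"
    and loc: "\<And>u v. agree R u v \<Longrightarrow> G u = G v" and aut: "automatic k y" and y: "slide G x = y"
  shows "\<exists>x'\<in>subst_shift \<phi>. quasi_fixed k \<phi> x' \<and> slide G x' = y"
proof (rule return_maps[OF cl k x loc aut y])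
  fix z c n J e
  assume z: "z \<in> subst_shift \<phi>" "x = shiftc c ((subst_seq k \<phi> ^^ n) z)"
    and J: "infinite J" "\<And>j. j \<in> J \<Longrightarrow> j \<ge> 1" "\<And>j. j \<in> J \<Longrightarrow> 0 \<le> e j \<and> e j < int k ^ j"
    "\<And>j u. j \<in> J \<Longrightarrow> slide G (shiftc c ((subst_seq k \<phi> ^^ n) u)) = y \<Longrightarrow>
      slide G (shiftc c ((subst_seq k \<phi> ^^ n) (shiftc (e j) ((subst_seq k \<phi> ^^ j) u)))) = y"
    "\<And>j u. j \<in> J \<Longrightarrow> agree 1 u z \<Longrightarrow> agree (k ^ j) (shiftc (e j) ((subst_seq k \<phi> ^^ j) u)) z"
  have k0: "k > 0" using k by simp
  obtain j where j: "j \<in> J" using infinite_imp_nonempty[OF J(1)] by blast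
  let ?V = "{u \<in> subst_shift \<phi>. slide G (shiftc c ((subst_seq k \<phi> ^^ n) u)) = y}"
  have "\<exists>u\<in>?V. shiftc (e j) ((subst_seq k \<phi> ^^ j) u) = u"
  proof (rule fixed_point_of_return_map[OF k J(2)[OF j], of _ _ z])
    have "1 \<le> k ^ j" using k0 by simp
    then show "agree 1 (shiftc (e j) ((subst_seq k \<phi> ^^ j) z)) z"
      by (rule agree_mono[OF J(5)[OF j agree_refl]])
    show "z \<in> ?V" using z y by simp
    show "shiftc (e j) ((subst_seq k \<phi> ^^ j) u) \<in> ?V" if "u \<in> ?V" for u
      using that J(4)[OF j] by (simp add: shiftc_in_subst_shift funpow_subst_seq_in_subst_shift[OF cl k0])
    show "u \<in> ?V" if u: "\<And>D. \<exists>v\<in>?V. agree D u v" for u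
    proof -
      have "u \<in> subst_shift \<phi>" by (rule subst_shift_closed) (use u in blast)
      moreover have "slide G (shiftc c ((subst_seq k \<phi> ^^ n) u)) = y"
        by (rule fibre_closed[OF k0 loc]) (use u in blast)+
      ultimately show ?thesis by simp
    qed
  qed (use J(3)[OF j] in auto)
  then obtain u where u: "u \<in> ?V" "shiftc (e j) ((subst_seq k \<phi> ^^ j) u) = u" by blast
  have "quasi_fixed k \<phi> (shiftc c ((subst_seq k \<phi> ^^ n) u))"
    by (rule quasi_fixed_shiftc_funpow[OF k0 J(2)[OF j] u(2)])
  moreover have "shiftc c ((subst_seq k \<phi> ^^ n) u) \<in> subst_shift \<phi>"
    using u(1) shiftc_in_subst_shift funpow_subst_seq_in_subst_shift[OF cl k0] by blast
  ultimately show ?thesis using u(1) by blast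
qed

text \<open>Here \<open>x\<close> may not be replaced by another preimage, so \<open>z\<close>
  itself has to be fixed; commutation of the return maps gives this.\<close>

lemma nonperiodic_preimage_quasi_fixed:
  fixes \<phi> :: "'a::finite \<Rightarrow> 'a list"
  assumes cl: "constant_length k \<phi>" and k: "k \<ge> 2" and x: "x \<in> subst_shift \<phi>"
    and loc: "\<And>u v. agree R u v \<Longrightarrow> G u = G v" and aut: "automatic k y" and y: "slide G x = y"
    and np: "\<not> periodic y"
  shows "quasi_fixed k \<phi> x"
proof (rule return_maps[OF cl k x loc aut y])
  fix z c n J e
  assume z: "z \<in> subst_shift \<phi>" "x = shiftc c ((subst_seq k \<phi> ^^ n) z)"
    and J: "infinite J" "\<And>j. j \<in> J \<Longrightarrow> j \<ge> 1" "\<And>j. j \<in> J \<Longrightarrow> 0 \<le> e j \<and> e j < int k ^ j"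
    "\<And>j u. j \<in> J \<Longrightarrow> slide G (shiftc c ((subst_seq k \<phi> ^^ n) u)) = y \<Longrightarrow>
      slide G (shiftc c ((subst_seq k \<phi> ^^ n) (shiftc (e j) ((subst_seq k \<phi> ^^ j) u)))) = y"
    "\<And>j u. j \<in> J \<Longrightarrow> agree 1 u z \<Longrightarrow> agree (k ^ j) (shiftc (e j) ((subst_seq k \<phi> ^^ j) u)) z"
  have k0: "k > 0" using k by simp
  define \<Psi> where "\<Psi> j u = shiftc (e j) ((subst_seq k \<phi> ^^ j) u)" for j u
  have comp: "\<Psi> i (\<Psi> j u) = shiftc (e i + int k ^ i * e j) ((subst_seq k \<phi> ^^ (i + j)) u)" for i j u
    by (simp add: \<Psi>_def funpow_subst_seq_shiftc[OF k0] shiftc_shiftc funpow_add)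
  \<comment> \<open>Both \<open>\<Psi> i (\<Psi> j z)\<close> and \<open>\<Psi> j (\<Psi> i z)\<close> lie in the fibre over \<open>y\<close> and they are shifts of each
    other, so \<open>y\<close> would be periodic if they differed by a nonzero shift.\<close>
  have comm: "e i + int k ^ i * e j = e j + int k ^ j * e i" if "i \<in> J" "j \<in> J" for i j
  proof (rule ccontr)
    let ?u = "(subst_seq k \<phi> ^^ (i + j)) z"
    let ?a = "e i + int k ^ i * e j" and ?b = "e j + int k ^ j * e i"
    assume ne: "?a \<noteq> ?b"
    have "slide G (shiftc c ((subst_seq k \<phi> ^^ n) (\<Psi> i (\<Psi> j z)))) = y"
      "slide G (shiftc c ((subst_seq k \<phi> ^^ n) (\<Psi> j (\<Psi> i z)))) = y"
      unfolding \<Psi>_def using J(4) that y z(2) by simp_all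
    then have a: "slide G (shiftc (c + int k ^ n * ?a) ((subst_seq k \<phi> ^^ n) ?u)) = y"
      and b: "slide G (shiftc (c + int k ^ n * ?b) ((subst_seq k \<phi> ^^ n) ?u)) = y"
      unfolding comp add.commute[of j i] funpow_subst_seq_shiftc[OF k0] shiftc_shiftc by simp_all
    have "shiftc (int k ^ n * (?b - ?a)) y = y"
      by (subst a[symmetric], subst slide_shiftc[symmetric], subst shiftc_shiftc, subst b[symmetric])
        (simp add: algebra_simps)
    moreover have "int k ^ n * (?b - ?a) \<noteq> 0" using ne k0 by simp
    ultimately show False using periodic_if_shiftc_eq np by blast
  qed
  have \<Psi>_comm: "\<Psi> i (\<Psi> j u) = \<Psi> j (\<Psi> i u)" if "i \<in> J" "j \<in> J" for i j u
    unfolding comp comm[OF that] by (simp add: add.commute)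
  obtain i where i: "i \<in> J" using infinite_imp_nonempty[OF J(1)] by blast
  have near: "agree (k ^ j) (\<Psi> j u) z" if "j \<in> J" "agree 1 u z" for j u
    unfolding \<Psi>_def by (rule J(5)[OF that])
  have i1: "agree 1 (\<Psi> i z) z"
    by (rule agree_mono[OF near[OF i agree_refl]]) (use k0 in simp)
  \<comment> \<open>As \<open>j\<close> grows in \<open>J\<close>,
    \<open>\<Psi> j (\<Psi> i z)\<close> tends to \<open>z\<close>, because
    \<open>\<Psi> i z\<close> agrees with \<open>z\<close> around the origin, while the equal
    sequence \<open>\<Psi> i (\<Psi> j z)\<close> tends to \<open>\<Psi> i z\<close>.\<close>
  have "agree D (\<Psi> i z) z" for D
  proof -
    obtain j where j: "j \<in> J" "j \<ge> Suc D"
      using infinite_nat_iff_unbounded_le[THEN iffD1, OF J(1), rule_format, of "Suc D"] by blast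
    have "Suc D \<le> k ^ j"
      using j(2) less_exp[of j] power_mono[of 2 k j] k by linarith
    then have "agree (Suc D) (\<Psi> j u) z" if "agree 1 u z" for u
      using near[OF j(1) that] agree_mono by blast
    then have 1: "agree (Suc D) (\<Psi> j z) z" and 2: "agree (Suc D) (\<Psi> j (\<Psi> i z)) z"
      using i1 by (auto simp: agree_def)
    have "agree D (\<Psi> i (\<Psi> j z)) (\<Psi> i z)"
      unfolding \<Psi>_def[of i]
    proof (rule agree_shiftc_funpow[OF k0 refl 1])
      fix p assume p: "\<bar>p\<bar> \<le> int D"
      define M where "M = int (Suc D) * int k ^ i"
      have "int (Suc D) * 1 \<le> M" unfolding M_def using k0 by (intro mult_left_mono) auto
      then show "- int (Suc D) * int k ^ i \<le> p + e i \<and> p + e i < (int (Suc D) + 1) * int k ^ i"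
        unfolding distrib_right minus_mult_left[symmetric] mult_1 M_def[symmetric]
        using p J(3)[OF i] by auto
    qed
    then show ?thesis
      using agree_mono[OF 2, of D] unfolding \<Psi>_comm[OF i j(1)] by (auto intro: agree_sym agree_trans)
  qed
  then have "\<Psi> i z = z" by (rule agree_all_eq)
  then show ?thesis
    unfolding z(2) \<Psi>_def by (rule quasi_fixed_shiftc_funpow[OF k0 J(2)[OF i]])
qed

theorem theorem3p1:
  fixes k :: nat
    and \<phi> :: "'a::finite \<Rightarrow> 'a list"
    and Y :: "(int \<Rightarrow> 'b::finite) set"
    and \<pi> :: "(int \<Rightarrow> 'a) \<Rightarrow> (int \<Rightarrow> 'b)"
  assumes "k \<ge> 2"
    and "constant_length k \<phi>"
    and "growing \<phi>"
    and "subshift Y"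
    and "factor_map (subst_shift \<phi>) Y \<pi>"
  shows "(\<forall>y\<in>Y. automatic k y \<longleftrightarrow>
            (\<exists>x\<in>subst_shift \<phi>. quasi_fixed k \<phi> x \<and> y = \<pi> x))
       \<and> (\<forall>y\<in>Y. automatic k y \<and> \<not> periodic y \<longrightarrow>
            (\<forall>x\<in>subst_shift \<phi>. \<pi> x = y \<longrightarrow> quasi_fixed k \<phi> x))"
proof -
  note k = assms(1) and cl = assms(2)
  obtain G R where loc: "\<And>u v. agree R u v \<Longrightarrow> G u = G v"
    and \<pi>: "\<And>x. x \<in> subst_shift \<phi> \<Longrightarrow> \<pi> x = slide G x"
    by (rule factor_map_is_slide[OF assms(5)]) blast
  show ?thesis
  proof (intro conjI ballI iffI impI)
    fix y assume y: "y \<in> Y" and aut: "automatic k y"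
    \<comment> \<open>Surjectivity gives some preimage, the starting point from which a quasi-fixed
      one is produced.\<close>
    have "\<pi> ` subst_shift \<phi> = Y" using assms(5) by (simp add: factor_map_def)
    then obtain x where x: "x \<in> subst_shift \<phi>" "slide G x = y" using y \<pi> by force
    from quasi_fixed_preimage_exists[OF cl k x(1) loc aut x(2)]
    show "\<exists>x\<in>subst_shift \<phi>. quasi_fixed k \<phi> x \<and> y = \<pi> x" by (auto simp: \<pi>)
  next
    fix y assume "\<exists>x\<in>subst_shift \<phi>. quasi_fixed k \<phi> x \<and> y = \<pi> x"
    then show "automatic k y" by (auto simp: \<pi> intro: automatic_slide_quasi_fixed[OF k loc])
  next
    fix y x
    assume y: "automatic k y \<and> \<not> periodic y" and x: "x \<in> subst_shift \<phi>" "\<pi> x = y"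
    have "slide G x = y" using \<pi> x by simp
    then show "quasi_fixed k \<phi> x"
      using nonperiodic_preimage_quasi_fixed[where G = G, OF cl k x(1) loc] y by blast
  qed
qed

end
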